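(* Let $A$ be an associative algebra, $M$ an $A$-bimodule and $P:M\to A$ a relative averaging operator. For every $n\ge 0$ and every $f\in CY^n(M,A)$, $$d_P(f)=(-1)^n\,\delta^P_{\mathrm{Diass}}(f),$$ where $d_P=\llbracket P,-\rrbracket$ and $\delta^P_{\mathrm{Diass}}$ is the coboundary operator of the induced diassociative algebra $M_P$ with coefficients in the representation $A$ (both defined in the context).
   Context: Everything is over a field $\mathbf k$ of characteristic $0$. Trees. $Y_n$ ($n\ge 1$) is the set of planar binary trees with $n$ trivalent vertices, one root and $n+1$ leaves labelled $0,1,\dots,n$ from left to right; $Y_0=\{|\}$. For $y_1\in Y_m,y_2\in Y_n$, the grafting $y_1\vee y_2\in Y_{m+n+1}$ joins the roots of $y_1$ (left) and $y_2$ (right) to a new vertex with a new root. $Y_2=\{y_\dashv,y_\vdash\}$, $y_\dashv=|\vee(|\vee|)$, $y_\vdash=(|\vee|)\vee|$. $d_i:Y_n\to Y_{n-1}$ deletes the $i$-th leaf ($0\le i\le n$). For $m,n\ge1$, $1\le i\le m$: $R_0^{m;i,n}:Y_{m+n-1}\to Y_m$ deletes the leaves labelled $i,\dots,i+n-2$, and $R_i^{m;i,n}:Y_{m+n-1}\to Y_n$ deletes the leaves labelled $0,\dots,i-2$ and $i+n,\dots,m+n-1$ (labels refer to the original tree). For $y\in Y_n$, $n\ge1$, symbols $\star_i^y\in\{\dashv,\vdash\}$: $\star_0^y=\dashv$ if $y=|\vee y_1$ for some $y_1\in Y_{n-1}$ and $\vdash$ otherwise; for $1\le i\le n-1$, $\star_i^y=\dashv$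 if the $i$-th leaf is oriented like $\backslash$ (it is a left child of its vertex) and $\vdash$ if it is oriented like $/$ (a right child); $\star_n^y=\vdash$ if $y=y_1\vee|$ for some $y_1\in Y_{n-1}$ and $\dashv$ otherwise. Majumdar-Mukherjee bracket. For vector spaces $D,D'$ put $CY^n(D,D')=\mathrm{Hom}(\mathbf k[Y_n]\otimes D^{\otimes n},D')$. For $f\in CY^m(D,D)$, $g\in CY^n(D,D)$, $m,n\geq 1$, $$(f\circ_i g)(y;a_1,\dots,a_{m+n-1})=f\big(R_0^{m;i,n}(y);a_1,\dots,a_{i-1},g(R_i^{m;i,n}(y);a_i,\dots,a_{i+n-1}),a_{i+n},\dots,a_{m+n-1}\big),$$ $$[f,g]_{\mathsf{MM}}=\sum_{i=1}^m(-1)^{(i-1)(n-1)}f\circ_i g-(-1)^{(m-1)(n-1)}\sum_{i=1}^n(-1)^{(i-1)(m-1)}g\circ_i f .$$ Relative averaging operator. A linear map $P:M\to A$ with $P(u)\cdot P(v)=P(P(u)\cdot_M v)=P(u\cdot_M P(v))$ for all $u,v\in M$, where $\cdot_M$ denotes both $A$-actions on $M$; $P$ is viewed in $CY^1(M,A)$ via $P(|\vee|;u)=P(u)$. The bracket $\llbracket\ ,\ \rrbracket$ on $CY^\bullet(M,A)$. Let $\Delta\in CY^2(A\oplus M,A\oplus M)$ be $$\Delta(y_\dashv;(a,u),(b,v))=(a\cdot b,u\cdot_M b),\qquad \Delta(y_\vdash;(a,u),(b,v))=(a\cdot b,a\cdot_M v).$$ Regard $CY^n(M,A)\subset CY^n(A\oplus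 M,A\oplus M)$ ($n\ge1$) by extension by zero. For $f\in CY^m(M,A)$, $g\in CY^n(M,A)$, $m,n\ge1$, set $\llbracket f,g\rrbracket=(-1)^m[[\Delta,f]_{\mathsf{MM}},g]_{\mathsf{MM}}$. For $a\in A=CY^0(M,A)$ and $f\in CY^m(M,A)$, $m\ge 1$, $$\llbracket f,a\rrbracket(y;u_1,\dots,u_m)=\sum_{i=1}^m f(y;u_1,\dots,u_{i-1},a\cdot_M u_i-u_i\cdot_M a,u_{i+1},\dots,u_m)+f(y;u_1,\dots,u_m)\cdot a-a\cdot f(y;u_1,\dots,u_m).$$ The coboundary $\delta^P_{\mathrm{Diass}}$. $M_P$ is the vector space $M$ with $u\dashv_P v=u\cdot_M P(v)$, $u\vdash_P v=P(u)\cdot_M v$ (a diassociative algebra). It is represented on $A$ by $u\dashv a=P(u)\cdot a-P(u\cdot_M a)$, $u\vdash a=P(u)\cdot a$, $a\dashv u=a\cdot P(u)$, $a\vdash u=a\cdot P(u)-P(a\cdot_M u)$. For $f\in CY^n(M,A)$, $y\in Y_{n+1}$, $u_1,\dots,u_{n+1}\in M$, $$\delta^P_{\mathrm{Diass}}(f)(y;u_1,\dots,u_{n+1})=u_1\star_0^y f(d_0y;u_2,\dots,u_{n+1})+\sum_{i=1}^n(-1)^i f(d_iy;u_1,\dots,u_i(\star_i^y)_P u_{i+1},\dots,u_{n+1})+(-1)^{n+1}f(d_{n+1}y;u_1,\dots,u_n)\star_{n+1}^y u_{n+1}.$$ *)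

theory Defs
  imports Complex_Main "HOL-Library.Tree" "HOL-Library.Product_Plus"
begin

section \<open>Planar binary trees\<close>

text \<open>
  The trivalent vertices are the inner nodes of a \<^typ>\<open>unit tree\<close> (counted by \<^const>\<open>size\<close>), the
  leaves are its \<^const>\<open>Leaf\<close>s (counted by \<^const>\<open>size1\<close>), numbered \<open>0, 1, \<dots>\<close> from left to right.
\<close>

type_synonym ptree = "unit tree"

definition trees :: "nat \<Rightarrow> ptree set"
  where "trees n = {y. size y = n}"

definition graft :: "ptree \<Rightarrow> ptree \<Rightarrow> ptree"
  where "graft y1 y2 = Node y1 () y2"

definition y_dashv :: ptree
  where "y_dashv = graft Leaf (graft Leaf Leaf)"

text \<open>Deleting the \<open>i\<close>-th leaf removes its parent vertex and puts the sibling subtree there.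
  The value on \<^const>\<open>Leaf\<close> is junk.\<close>

fun del_leaf :: "nat \<Rightarrow> ptree \<Rightarrow> ptree"
  where
    "del_leaf i Leaf = Leaf"
  | "del_leaf i (Node l _ r) =
       (if i < size1 l
        then (if l = Leaf then r else graft (del_leaf i l) r)
        else (if r = Leaf then l else graft l (del_leaf (i - size1 l) r)))"

text \<open>For an increasing list of labels of the original tree; the largest label is deleted first,
  so that the remaining labels in the list stay valid.\<close>

definition del_leaves :: "nat list \<Rightarrow> ptree \<Rightarrow> ptree"
  where "del_leaves labels y = foldr del_leaf labels y"

definition R_outer :: "nat \<Rightarrow> nat \<Rightarrow> nat \<Rightarrow> ptree \<Rightarrow> ptree"  \<comment> \<open>\<open>R\<^sub>0\<close> with superscript \<open>m; i, n\<close>\<close>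
  where "R_outer m i n y = del_leaves [i..<i + n - 1] y"

definition R_inner :: "nat \<Rightarrow> nat \<Rightarrow> nat \<Rightarrow> ptree \<Rightarrow> ptree"  \<comment> \<open>\<open>R\<^sub>i\<close> with superscript \<open>m; i, n\<close>\<close>
  where "R_inner m i n y = del_leaves ([0..<i - 1] @ [i + n..<m + n]) y"

fun is_left_leaf :: "nat \<Rightarrow> ptree \<Rightarrow> bool"
  where
    "is_left_leaf i Leaf = False"
  | "is_left_leaf i (Node l _ r) =
       (if i < size1 l then l = Leaf \<or> is_left_leaf i l
        else r \<noteq> Leaf \<and> is_left_leaf (i - size1 l) r)"

datatype dsym = Dashv | Vdash

definition star :: "nat \<Rightarrow> ptree \<Rightarrow> dsym"
  where "star i y =
    (if i = 0 then (if \<exists>y1. y = graft Leaf y1 then Dashv else Vdash)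
     else if i = size y then (if \<exists>y1. y = graft y1 Leaf then Vdash else Dashv)
     else if is_left_leaf i y then Dashv else Vdash)"


section \<open>Cochains and the Majumdar-Mukherjee bracket\<close>

text \<open>A cochain is given by its values on trees and argument lists. Only the values on trees with
  \<open>n\<close> vertices and lists of length \<open>n\<close> are meaningful, and cochains of degree \<open>n\<close> are compared
  only there; a cochain \<open>f\<close> of degree \<open>0\<close> is the single vector \<open>f Leaf []\<close>.\<close>

type_synonym ('d, 'e) cochain = "ptree \<Rightarrow> 'd list \<Rightarrow> 'e"

definition CY :: "('k::field \<Rightarrow> 'd::ab_group_add \<Rightarrow> 'd) \<Rightarrow> ('k \<Rightarrow> 'e::ab_group_add \<Rightarrow> 'e) \<Rightarrow> nat
    \<Rightarrow> ('d, 'e) cochain set"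
  where "CY scaleD scaleE n =
    {f. \<forall>y\<in>trees n. \<forall>as. length as = n \<longrightarrow>
          (\<forall>i<n. Vector_Spaces.linear scaleD scaleE (\<lambda>x. f y (as[i := x])))}"

definition signed :: "nat \<Rightarrow> 'e::ab_group_add \<Rightarrow> 'e"  \<comment> \<open>multiplication by \<open>(-1)\<close> to the power \<open>k\<close>\<close>
  where "signed k x = (if even k then x else - x)"

text \<open>In the following operations the number arguments are the degrees of the cochains.\<close>

definition circ :: "nat \<Rightarrow> ('d, 'd) cochain \<Rightarrow> nat \<Rightarrow> nat \<Rightarrow> ('d, 'd) cochain \<Rightarrow> ('d, 'd) cochain"
  where "circ m f i n g y as =
    f (R_outer m i n y)
      (take (i - 1) as @ [g (R_inner m i n y) (take n (drop (i - 1) as))] @ drop (i + n - 1) as)"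

definition MM :: "nat \<Rightarrow> ('d::ab_group_add, 'd) cochain \<Rightarrow> nat \<Rightarrow> ('d, 'd) cochain
    \<Rightarrow> ('d, 'd) cochain"
  where "MM m f n g y as =
    (\<Sum>i = 1..m. signed ((i - 1) * (n - 1)) (circ m f i n g y as))
    - signed ((m - 1) * (n - 1)) (\<Sum>i = 1..n. signed ((i - 1) * (m - 1)) (circ n g i m f y as))"


section \<open>Bimodules and relative averaging operators\<close>

text \<open>The class \<^class>\<open>ring\<close> is that of associative rings without assumed unit.\<close>

locale assoc_algebra = vector_space scaleA
  for scaleA :: "'k::field_char_0 \<Rightarrow> 'a::ring \<Rightarrow> 'a" +
  assumes scale_mult_left: "scaleA c (a * b) = scaleA c a * b"
    and scale_mult_right: "scaleA c (a * b) = a * scaleA c b"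

locale alg_bimodule = assoc_algebra scaleA + M: vector_space scaleM
  for scaleA :: "'k::field_char_0 \<Rightarrow> 'a::ring \<Rightarrow> 'a"
    and scaleM :: "'k \<Rightarrow> 'm::ab_group_add \<Rightarrow> 'm" +
  fixes lact :: "'a \<Rightarrow> 'm \<Rightarrow> 'm"
    and ract :: "'m \<Rightarrow> 'a \<Rightarrow> 'm"
  assumes lact_linear_left: "Vector_Spaces.linear scaleA scaleM (\<lambda>a. lact a u)"
    and lact_linear_right: "Vector_Spaces.linear scaleM scaleM (lact a)"
    and ract_linear_left: "Vector_Spaces.linear scaleM scaleM (\<lambda>u. ract u a)"
    and ract_linear_right: "Vector_Spaces.linear scaleA scaleM (ract u)"
    and lact_lact: "lact a (lact b u) = lact (a * b) u"
    and ract_ract: "ract (ract u a) b = ract u (a * b)"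
    and lact_ract: "ract (lact a u) b = lact a (ract u b)"

locale relative_averaging = alg_bimodule scaleA scaleM lact ract
  for scaleA :: "'k::field_char_0 \<Rightarrow> 'a::ring \<Rightarrow> 'a"
    and scaleM :: "'k \<Rightarrow> 'm::ab_group_add \<Rightarrow> 'm"
    and lact :: "'a \<Rightarrow> 'm \<Rightarrow> 'm"
    and ract :: "'m \<Rightarrow> 'a \<Rightarrow> 'm" +
  fixes P :: "'m \<Rightarrow> 'a"
  assumes P_linear: "Vector_Spaces.linear scaleM scaleA P"
    and averaging_left: "P u * P v = P (lact (P u) v)"
    and averaging_right: "P u * P v = P (ract u (P v))"


section \<open>The derived bracket and the differential\<close>

definition Delta :: "('a::ring \<Rightarrow> 'm \<Rightarrow> 'm) \<Rightarrow> ('m \<Rightarrow> 'a \<Rightarrow> 'm) \<Rightarrow> ('a \<times> 'm, 'a \<times> 'm) cochain"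
  where "Delta lact ract y xs =
    (let (a, u) = xs ! 0; (b, v) = xs ! 1
     in (a * b, if y = y_dashv then ract u b else lact a v))"

text \<open>Extension by zero along the decomposition of the tensor powers of \<open>A \<oplus> M\<close>, i.e. composition
  with the projection to \<open>M\<close> in every argument and with the inclusion of \<open>A\<close>.\<close>

definition ext :: "('m, 'a) cochain \<Rightarrow> ('a \<times> 'm, 'a \<times> 'm::zero) cochain"
  where "ext f y xs = (f y (map snd xs), 0)"

definition bracket_elem :: "('a::ring \<Rightarrow> 'm \<Rightarrow> 'm::ab_group_add) \<Rightarrow> ('m \<Rightarrow> 'a \<Rightarrow> 'm)
    \<Rightarrow> nat \<Rightarrow> ('m, 'a) cochain \<Rightarrow> 'a \<Rightarrow> ('m, 'a) cochain"
  where "bracket_elem lact ract m f a y us =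
    (\<Sum>i = 1..m. f y (us[i - 1 := lact a (us ! (i - 1)) - ract (us ! (i - 1)) a]))
    + f y us * a - a * f y us"

text \<open>The bracket of \<open>f\<close> (of degree \<open>m \<ge> 1\<close>) and \<open>g\<close> (of degree \<open>n \<ge> 0\<close>), as a cochain on
  \<open>A \<oplus> M\<close>. That it is the extension by zero of a cochain on \<open>M\<close> is not built in for \<open>n \<ge> 1\<close>.\<close>

definition bracket :: "('a::ring \<Rightarrow> 'm \<Rightarrow> 'm::ab_group_add) \<Rightarrow> ('m \<Rightarrow> 'a \<Rightarrow> 'm)
    \<Rightarrow> nat \<Rightarrow> ('m, 'a) cochain \<Rightarrow> nat \<Rightarrow> ('m, 'a) cochain \<Rightarrow> ('a \<times> 'm, 'a \<times> 'm) cochain"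
  where "bracket lact ract m f n g =
    (if n = 0 then ext (bracket_elem lact ract m f (g Leaf []))
     else (\<lambda>y xs. signed m (MM (m + 1) (MM 2 (Delta lact ract) m (ext f)) n (ext g) y xs)))"

definition map_cochain :: "('m \<Rightarrow> 'a) \<Rightarrow> ('m, 'a) cochain"
  where "map_cochain P y us = P (us ! 0)"

definition d_P :: "('a::ring \<Rightarrow> 'm \<Rightarrow> 'm::ab_group_add) \<Rightarrow> ('m \<Rightarrow> 'a \<Rightarrow> 'm) \<Rightarrow> ('m \<Rightarrow> 'a)
    \<Rightarrow> nat \<Rightarrow> ('m, 'a) cochain \<Rightarrow> ('a \<times> 'm, 'a \<times> 'm) cochain"
  where "d_P lact ract P n f = bracket lact ract 1 (map_cochain P) n f"


section \<open>The coboundary of a diassociative algebra with coefficients in a representation\<close>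

definition diass_coboundary :: "(dsym \<Rightarrow> 'd \<Rightarrow> 'd \<Rightarrow> 'd) \<Rightarrow> (dsym \<Rightarrow> 'd \<Rightarrow> 'e \<Rightarrow> 'e)
    \<Rightarrow> (dsym \<Rightarrow> 'e \<Rightarrow> 'd \<Rightarrow> 'e) \<Rightarrow> nat \<Rightarrow> ('d, 'e::ab_group_add) cochain \<Rightarrow> ('d, 'e) cochain"
  where "diass_coboundary mult lrep rrep n f y us =
    lrep (star 0 y) (us ! 0) (f (del_leaf 0 y) (drop 1 us))
    + (\<Sum>i = 1..n. signed i
        (f (del_leaf i y)
           (take (i - 1) us @ [mult (star i y) (us ! (i - 1)) (us ! i)] @ drop (i + 1) us)))
    + signed (n + 1) (rrep (star (n + 1) y) (f (del_leaf (n + 1) y) (take n us)) (us ! n))"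

fun mult_P :: "('a \<Rightarrow> 'm \<Rightarrow> 'm) \<Rightarrow> ('m \<Rightarrow> 'a \<Rightarrow> 'm) \<Rightarrow> ('m \<Rightarrow> 'a) \<Rightarrow> dsym \<Rightarrow> 'm \<Rightarrow> 'm \<Rightarrow> 'm"
  where
    "mult_P lact ract P Dashv u v = ract u (P v)"
  | "mult_P lact ract P Vdash u v = lact (P u) v"

fun lrep_P :: "('m \<Rightarrow> 'a \<Rightarrow> 'm) \<Rightarrow> ('m \<Rightarrow> 'a::ring) \<Rightarrow> dsym \<Rightarrow> 'm \<Rightarrow> 'a \<Rightarrow> 'a"
  where
    "lrep_P ract P Dashv u a = P u * a - P (ract u a)"
  | "lrep_P ract P Vdash u a = P u * a"

fun rrep_P :: "('a \<Rightarrow> 'm \<Rightarrow> 'm) \<Rightarrow> ('m \<Rightarrow> 'a::ring) \<Rightarrow> dsym \<Rightarrow> 'a \<Rightarrow> 'm \<Rightarrow> 'a"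
  where
    "rrep_P lact P Dashv a u = a * P u"
  | "rrep_P lact P Vdash a u = a * P u - P (lact a u)"

definition delta_P :: "('a::ring \<Rightarrow> 'm \<Rightarrow> 'm) \<Rightarrow> ('m \<Rightarrow> 'a \<Rightarrow> 'm) \<Rightarrow> ('m \<Rightarrow> 'a)
    \<Rightarrow> nat \<Rightarrow> ('m, 'a) cochain \<Rightarrow> ('m, 'a) cochain"
  where "delta_P lact ract P =
    diass_coboundary (mult_P lact ract P) (lrep_P ract P) (rrep_P lact P)"

end

theory Submission
  imports Defs
begin

text \<open>
  Put \<open>D = [\<Delta>, P]\<close>, a cochain of degree 2. Up to signs, the terms of \<open>\<lbrakk>P, f\<rbrakk> = -[D, f]\<close> are \<open>D \<circ>\<^sub>2 f\<close>,
  \<open>f \<circ>\<^sub>i D\<close> and \<open>D \<circ>\<^sub>1 f\<close>, and they are respectively the first, the middle and the last terms of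
  \<open>\<delta> f\<close>. On the side of the algebra this is read off from the values of \<open>D\<close>, in which an argument
  from \<open>A\<close> or from \<open>M\<close> kills the terms that are not wanted. On the side of the trees one has to see
  which of the two trees with two vertices is spanned by three given leaves of \<open>y\<close>. It is decided at
  the vertex where the first leaf is separated from the third, by the side to which the second leaf
  goes; this description is insensitive to the deletion of other leaves.
\<close>

section \<open>The subtree spanned by three leaves\<close>

text \<open>Intended for \<open>p < q < r < size1 y\<close>: the first two tests follow the subtree
  that contains all three leaves, the last branch is the vertex where \<open>p\<close> and
  \<open>r\<close> part.\<close>

fun spans_dashv :: "ptree \<Rightarrow> nat \<Rightarrow> nat \<Rightarrow> nat \<Rightarrow> bool"
  where
    "spans_dashv Leaf p q r = False"
  | "spans_dashv (Node t1 _ t2) p q r =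
      (if r < size1 t1 then spans_dashv t1 p q r
       else if size1 t1 \<le> p then spans_dashv t2 (p - size1 t1) (q - size1 t1) (r - size1 t1)
       else size1 t1 \<le> q)"

lemma size_del_leaf: "i < size1 y \<Longrightarrow> size (del_leaf i y) = size y - 1"
proof (induction i y rule: del_leaf.induct)
  case (2 i l u r)
  have "l \<noteq> Leaf \<Longrightarrow> Suc (size l - 1) = size l" "r \<noteq> Leaf \<Longrightarrow> Suc (size r - 1) = size r"
    by (cases l; simp) (cases r; simp)
  then show ?case
    using 2 by (auto simp: graft_def size1_size)
qed simp

lemma size1_del_leaf: "i < size1 y \<Longrightarrow> y \<noteq> Leaf \<Longrightarrow> size1 (del_leaf i y) = size1 y - 1"
  using size_del_leaf[of i y] by (cases y) (auto simp: size1_size)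

text \<open>Only the parent of leaf \<open>j\<close> disappears. It cannot be the vertex separating
  \<open>p\<close> from \<open>r\<close>: there \<open>j\<close> alone would form one side, but
  \<open>p\<close> or \<open>r\<close> lies on that side. The conditionals renumber the leaves to
  the right of \<open>j\<close>.\<close>

lemma spans_dashv_del_leaf:
  assumes "j < size1 y" "p < q" "q < r" "r < size1 y" "j \<notin> {p, q, r}"
  shows "spans_dashv (del_leaf j y) (if j < p then p - 1 else p) (if j < q then q - 1 else q)
    (if j < r then r - 1 else r) = spans_dashv y p q r"
  using assms
proof (induction y arbitrary: j p q r)
  case Leaf
  then show ?case by simp
next
  case (Node t1 u t2)
  note pos = size1_ge0[of t1] size1_ge0[of t2]
  show ?case
  proof (cases "j < size1 t1")
    case j: True
    show ?thesis
    proof (cases "t1 = Leaf")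
      case True
      \<comment> \<open>Here \<open>j = 0\<close> and the root disappears with it, but the other
        three leaves all lie in \<open>t2\<close>.\<close>
      then show ?thesis
        using j Node.prems by (auto simp: Suc_diff_le)
    next
      case False
      then have "size1 (del_leaf j t1) = size1 t1 - 1"
        using j size1_del_leaf by blast
      moreover have "size1 t1 \<noteq> 0" using pos by simp
      moreover have "r < size1 t1 \<Longrightarrow> spans_dashv (del_leaf j t1) (if j < p then p - 1 else p)
          (if j < q then q - 1 else q) (if j < r then r - 1 else r) = spans_dashv t1 p q r"
        using j Node.prems by (intro Node.IH) auto
      moreover have "x - Suc 0 - (size1 t1 - Suc 0) = x - size1 t1" for x
        using pos by simp
      ultimately show ?thesis
        using j False Node.prems
        by (cases "r < size1 t1"; cases "size1 t1 \<le> p"; cases "size1 t1 \<le> q")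
          (auto simp: graft_def)
    qed
  next
    case j: False
    define k where "k = size1 t1"
    show ?thesis
    proof (cases "t2 = Leaf")
      case True
      then show ?thesis
        using j Node.prems by auto
    next
      case False
      have "k \<le> p \<Longrightarrow> spans_dashv (del_leaf (j - k) t2)
          (if j - k < p - k then p - k - 1 else p - k) (if j - k < q - k then q - k - 1 else q - k)
          (if j - k < r - k then r - k - 1 else r - k) = spans_dashv t2 (p - k) (q - k) (r - k)"
        using j Node.prems unfolding k_def by (intro Node.IH) auto
      \<comment> \<open>Renumbering after the deletion commutes with passing to the labels of
        \<open>t2\<close>.\<close>
      moreover have "k \<le> p \<Longrightarrow> (if j - k < x - k then x - k - 1 else x - k)
          = (if j < x then x - 1 else x) - k" if "p \<le> x" for x
        using that j unfolding k_def by auto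
      ultimately have "k \<le> p \<Longrightarrow> spans_dashv (del_leaf (j - k) t2)
          ((if j < p then p - 1 else p) - k) ((if j < q then q - 1 else q) - k)
          ((if j < r then r - 1 else r) - k) = spans_dashv t2 (p - k) (q - k) (r - k)"
        using Node.prems by simp
      then show ?thesis
        using j False Node.prems pos
        by (cases "r < k"; cases "k \<le> p"; cases "k \<le> q") (auto simp: graft_def k_def[symmetric])
    qed
  qed
qed

section \<open>Deleting runs of consecutive leaves\<close>

lemma del_leaves_append: "del_leaves (ks @ ls) y = del_leaves ks (del_leaves ls y)"
  by (simp add: del_leaves_def)

lemma del_leaves_Nil [simp]: "del_leaves [] y = y"
  by (simp add: del_leaves_def)

lemma del_leaves_singleton [simp]: "del_leaves [i] y = del_leaf i y"
  by (simp add: del_leaves_def)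

text \<open>Iterates the single deletion. The largest label goes first, so the induction is on the
  upper end \<open>b\<close> and its hypothesis is applied to \<open>del_leaf b y\<close>, hence the
  arbitrary tree and leaves.\<close>

lemma spans_dashv_del_leaves_upt:
  assumes "a \<le> b" "b \<le> size1 y" "p < q" "q < r" "r < size1 y"
    and "p < a \<or> b \<le> p" "q < a \<or> b \<le> q" "r < a \<or> b \<le> r"
  shows "size1 (del_leaves [a..<b] y) = size1 y - (b - a)"
    and "spans_dashv (del_leaves [a..<b] y) (if p < a then p else p - (b - a))
      (if q < a then q else q - (b - a)) (if r < a then r else r - (b - a)) = spans_dashv y p q r"
  using assms
proof (induction b arbitrary: y p q r rule: dec_induct)
  case base
  { case 1 then show ?case by simp }
  { case 2 then show ?case by simp }
next
  case (step b)
  let ?s = "\<lambda>x. if b < x then x - 1 else x"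
  { fix y :: ptree and p q r :: nat
    assume prems: "Suc b \<le> size1 y" "p < q" "q < r" "r < size1 y"
      "p < a \<or> Suc b \<le> p" "q < a \<or> Suc b \<le> q" "r < a \<or> Suc b \<le> r"
    have "y \<noteq> Leaf" using prems by auto
    then have size1: "size1 (del_leaf b y) = size1 y - 1"
      using prems by (simp add: size1_del_leaf)
    have spans: "spans_dashv (del_leaf b y) (?s p) (?s q) (?s r) = spans_dashv y p q r"
      using prems step.hyps by (intro spans_dashv_del_leaf) auto
    have shifted: "b \<le> size1 (del_leaf b y)" "?s p < ?s q" "?s q < ?s r"
      "?s r < size1 (del_leaf b y)" "?s p < a \<or> b \<le> ?s p" "?s q < a \<or> b \<le> ?s q"
      "?s r < a \<or> b \<le> ?s r"
      using prems step.hyps size1 by auto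
    \<comment> \<open>Moving down by one past \<open>b\<close> and then by \<open>b - a\<close> is
      moving down by \<open>Suc b - a\<close>.\<close>
    have "(if ?s x < a then ?s x else ?s x - (b - a)) = (if x < a then x else x - (Suc b - a))"
      if "x < a \<or> Suc b \<le> x" for x
      using that step.hyps by auto
    with prems step.IH(2)[OF shifted] spans
    have "spans_dashv (del_leaves [a..<b] (del_leaf b y)) (if p < a then p else p - (Suc b - a))
        (if q < a then q else q - (Suc b - a)) (if r < a then r else r - (Suc b - a))
        = spans_dashv y p q r"
      by simp
    moreover have "size1 (del_leaves [a..<b] (del_leaf b y)) = size1 y - (Suc b - a)"
      using step.IH(1)[OF shifted] size1 step.hyps by simp
    ultimately have
      "size1 (del_leaves [a..<Suc b] y) = size1 y - (Suc b - a)"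
      "spans_dashv (del_leaves [a..<Suc b] y) (if p < a then p else p - (Suc b - a))
        (if q < a then q else q - (Suc b - a)) (if r < a then r else r - (Suc b - a))
        = spans_dashv y p q r"
      using step.hyps by (simp_all add: del_leaves_append)
  }
  note * = this
  { case 1 then show ?case by (rule *(1)) }
  { case 2 then show ?case by (rule *(2)) }
qed

section \<open>Recognizing \<open>y_dashv\<close> and the symbols \<open>star\<close>\<close>

lemma eq_y_dashv_iff:
  assumes "size1 y = 3"
  shows "y = y_dashv \<longleftrightarrow> spans_dashv y 0 1 2"
proof (cases y)
  case (Node l u r)
  then have "size l + size r = 1" using assms by (simp add: size1_size)
  then consider "size l = 0" "size r = 1" | "size l = 1" "size r = 0" by linarith
  then show ?thesis
  proof cases
    case 1
    then have "l = Leaf" "r = Node Leaf () Leaf" by (cases r; auto)+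
    then show ?thesis using Node by (simp add: y_dashv_def graft_def)
  next
    case 2
    then have "l = Node Leaf () Leaf" "r = Leaf" by (cases l; auto)+
    then show ?thesis using Node by (simp add: y_dashv_def graft_def)
  qed
qed (use assms in simp)

lemma is_left_leaf_0: "y \<noteq> Leaf \<Longrightarrow> is_left_leaf 0 y"
  by (induction y) (use size1_ge0 in auto)

lemma not_is_left_leaf_size: "\<not> is_left_leaf (size y) y"
  by (induction y) (auto simp: size1_size)

text \<open>If leaf \<open>i\<close> is a left child, leaf \<open>i + 1\<close> lies in the sibling
  subtree and leaf \<open>i - 1\<close> outside, so \<open>i\<close> is still with
  \<open>i + 1\<close> when \<open>i - 1\<close> splits off. The other orientation is the mirror
  image.\<close>

lemma is_left_leaf_iff:
  assumes "0 < i" "i + 1 < size1 y"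
  shows "is_left_leaf i y \<longleftrightarrow> spans_dashv y (i - 1) i (i + 1)"
  using assms
proof (induction y arbitrary: i)
  case (Node l u r)
  consider "i + 1 < size1 l" | "i + 1 = size1 l" | "i = size1 l" | "size1 l < i" by linarith
  then show ?case
  proof cases
    case 1
    then show ?thesis using Node by auto
  next
    case 2
    \<comment> \<open>The root splits \<open>i\<close> from \<open>i + 1\<close>, so
      \<open>i\<close> is the last leaf of \<open>l\<close>, a right child.\<close>
    then have "i = size l" by (simp add: size1_size)
    then show ?thesis using 2 Node.prems not_is_left_leaf_size[of l] by auto
  next
    case 3
    \<comment> \<open>The root splits \<open>i - 1\<close> from \<open>i\<close>, so
      \<open>i\<close> is the first leaf of \<open>r\<close>, a left child.\<close>
    then have "r \<noteq> Leaf" using Node.prems by auto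
    moreover have "\<not> size1 l \<le> size1 l - 1"
      using size1_ge0[of l] by linarith
    ultimately show ?thesis using 3 Node.prems by (auto simp: is_left_leaf_0)
  next
    case 4
    then have "r \<noteq> Leaf" using Node.prems by auto
    then show ?thesis using 4 Node.prems Node.IH(2)[of "i - size1 l"]
      by (auto simp: Suc_diff_le diff_right_commute)
  qed
qed simp

text \<open>The leaves left over are \<open>0\<close>, \<open>1\<close> and \<open>n + 1\<close>.
  The outermost two part at the root, and leaf \<open>1\<close> goes right exactly when the left
  subtree is a single leaf.\<close>

lemma star_0_iff:
  assumes "size y = n + 1" "1 \<le> n"
  shows "R_outer 2 2 n y = y_dashv \<longleftrightarrow> star 0 y = Dashv"
proof -
  have "size1 (R_outer 2 2 n y) = 3"
    "spans_dashv (R_outer 2 2 n y) 0 1 2 = spans_dashv y 0 1 (n + 1)"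
    using spans_dashv_del_leaves_upt[of 2 "n + 1" y 0 1 "n + 1"] assms
    by (simp_all add: R_outer_def size1_size numeral_2_eq_2)
  then have "R_outer 2 2 n y = y_dashv \<longleftrightarrow> spans_dashv y 0 1 (n + 1)"
    by (simp add: eq_y_dashv_iff)
  also have "\<dots> \<longleftrightarrow> star 0 y = Dashv"
    using assms by (cases y) (auto simp: star_def graft_def size1_size eq_size_0)
  finally show ?thesis .
qed

text \<open>Now \<open>0\<close>, \<open>n\<close> and \<open>n + 1\<close> are left over, and leaf
  \<open>n\<close> goes left at the root exactly when the right subtree is a single leaf.\<close>

lemma star_last_iff:
  assumes "size y = n + 1" "1 \<le> n"
  shows "R_outer 2 1 n y = y_dashv \<longleftrightarrow> star (n + 1) y = Dashv"
proof -
  have "size1 (R_outer 2 1 n y) = 3"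
    "spans_dashv (R_outer 2 1 n y) 0 1 2 = spans_dashv y 0 n (n + 1)"
    using spans_dashv_del_leaves_upt[of 1 n y 0 n "n + 1"] assms
    by (simp_all add: R_outer_def size1_size numeral_2_eq_2)
  then have "R_outer 2 1 n y = y_dashv \<longleftrightarrow> spans_dashv y 0 n (n + 1)"
    by (simp add: eq_y_dashv_iff)
  also have "\<dots> \<longleftrightarrow> star (n + 1) y = Dashv"
    using assms by (cases y; cases "right y") (auto simp: star_def graft_def size1_size eq_size_0)
  finally show ?thesis .
qed

text \<open>Cutting off both ends leaves \<open>i - 1\<close>, \<open>i\<close> and
  \<open>i + 1\<close>. The right end goes first, giving \<open>z\<close>, in which these labels are
  unchanged.\<close>

lemma star_middle_iff:
  assumes "size y = n + 1" "1 \<le> i" "i \<le> n"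
  shows "R_inner n i 2 y = y_dashv \<longleftrightarrow> star i y = Dashv"
proof -
  have lt: "i - 1 < i + 2" by simp
  define z where "z = del_leaves [i + 2..<n + 2] y"
  have z: "size1 z = i + 2" "spans_dashv z (i - 1) i (i + 1) = spans_dashv y (i - 1) i (i + 1)"
    using spans_dashv_del_leaves_upt[of "i + 2" "n + 2" y "i - 1" i "i + 1"] assms lt
    by (auto simp: z_def size1_size)
  have "R_inner n i 2 y = del_leaves [0..<i - 1] z"
    by (simp add: R_inner_def z_def del_leaves_append)
  then have "size1 (R_inner n i 2 y) = 3"
    "spans_dashv (R_inner n i 2 y) 0 1 2 = spans_dashv z (i - 1) i (i + 1)"
    using spans_dashv_del_leaves_upt[of 0 "i - 1" z "i - 1" i "i + 1"] assms z
    by (simp_all add: numeral_2_eq_2)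
  then have "R_inner n i 2 y = y_dashv \<longleftrightarrow> is_left_leaf i y"
    using z assms by (simp add: eq_y_dashv_iff is_left_leaf_iff size1_size)
  also have "\<dots> \<longleftrightarrow> star i y = Dashv"
    using assms by (simp add: star_def)
  finally show ?thesis .
qed


section \<open>The differential\<close>

lemma signed_Pair: "signed k (a, b) = (signed k a, signed k b)"
  by (simp add: signed_def)

lemma signed_0 [simp]: "signed k 0 = 0"
  by (simp add: signed_def)

lemma signed_sum: "signed k (sum h S) = (\<Sum>i\<in>S. signed k (h i))"
  by (simp add: signed_def sum_negf)

lemma signed_add: "signed k (x + y) = signed k x + signed k y"
  by (simp add: signed_def)

lemma signed_signed: "signed k (signed l x) = signed (k + l) x"
  by (simp add: signed_def)

lemma sum_Pair_0: "(\<Sum>i\<in>S. (h i, 0)) = (sum h S, 0)"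
  by (induction S rule: infinite_finite_induct) (simp_all add: zero_prod_def)

section \<open>The cochain \<open>D\<close> and its compositions with \<open>f\<close>\<close>

context relative_averaging
begin

text \<open>Values of \<open>ext\<close> have the form \<open>(a, 0)\<close>; these rules erase the
  terms of \<open>Delta\<close> and \<open>D\<close> that such an argument kills.\<close>

lemma zero_simps [simp]:
  "lact 0 u = 0" "lact a 0 = 0" "ract 0 a = 0" "ract u 0 = 0" "P 0 = 0"
proof -
  have zero: "Vector_Spaces.linear s1 s2 h \<Longrightarrow> h 0 = 0"
    for s1 :: "'k \<Rightarrow> 'x::ab_group_add \<Rightarrow> 'x" and s2 :: "'k \<Rightarrow> 'y::ab_group_add \<Rightarrow> 'y" and h
    by (simp add: linear_iff_module_hom module_hom.zero)
  show "lact 0 u = 0" "lact a 0 = 0" "ract 0 a = 0" "ract u 0 = 0" "P 0 = 0"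
    using zero[OF lact_linear_left] zero[OF lact_linear_right] zero[OF ract_linear_left]
      zero[OF ract_linear_right] zero[OF P_linear] by blast+
qed

lemma P_diff: "P (u - v) = P u - P v"
  using P_linear by (simp add: linear_iff_module_hom module_hom.diff)

definition D :: "('a \<times> 'm, 'a \<times> 'm) cochain"
  where "D = MM 2 (Delta lact ract) 1 (ext (map_cochain P))"

text \<open>In these degrees all signs of the bracket are positive, apart from the minus before
  \<open>P\<close> composed with \<open>Delta\<close>. The second component is the product of
  \<open>M_P\<close>; the first, with \<open>u = 0\<close> or \<open>v = 0\<close> in one slot,
  gives the right or left action on \<open>A\<close> once the other argument is in place.\<close>

lemma D_eq:
  "D y [(a, u), (b, v)] = (if y = y_dashv
    then (P u * b + a * P v - P (ract u b), ract u (P v))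
    else (P u * b + a * P v - P (lact a v), lact (P u) v))"
  by (simp add: D_def MM_def circ_def Delta_def ext_def map_cochain_def R_outer_def R_inner_def
      signed_def numeral_2_eq_2)

lemma circ_D_left:
  assumes "size y = n + 1" "1 \<le> n" "length xs = n + 1"
  shows "circ 2 D 1 n (ext f) y xs =
    (rrep_P lact P (star (n + 1) y) (f (del_leaf (n + 1) y) (take n (map snd xs)))
      (map snd xs ! n), 0)"
proof -
  obtain b v where x: "xs ! n = (b, v)" by fastforce
  have "drop n xs = [(b, v)]"
    using assms Cons_nth_drop_Suc[of n xs] x by simp
  moreover have "R_inner 2 1 n y = del_leaf (n + 1) y"
    by (simp add: R_inner_def)
  moreover have "map snd xs ! n = v"
    using assms x by simp
  ultimately show ?thesis
    using star_last_iff[OF assms(1,2)]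
    by (cases "star (n + 1) y") (simp_all add: circ_def ext_def D_eq take_map)
qed

lemma circ_D_right:
  assumes "size y = n + 1" "1 \<le> n" "length xs = n + 1"
  shows "circ 2 D 2 n (ext f) y xs =
    (lrep_P ract P (star 0 y) (map snd xs ! 0) (f (del_leaf 0 y) (drop 1 (map snd xs))), 0)"
proof -
  obtain a u xs' where xs: "xs = (a, u) # xs'" "length xs' = n"
    using assms by (cases xs) auto
  moreover have "R_inner 2 2 n y = del_leaf 0 y"
    by (simp add: R_inner_def)
  ultimately show ?thesis
    using star_0_iff[OF assms(1,2)]
    by (cases "star 0 y") (simp_all add: circ_def ext_def D_eq)
qed

lemma circ_ext_D:
  assumes "size y = n + 1" "1 \<le> i" "i \<le> n" "length xs = n + 1"
  shows "circ n (ext f) i 2 D y xs =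
    (f (del_leaf i y) (take (i - 1) (map snd xs)
      @ [mult_P lact ract P (star i y) (map snd xs ! (i - 1)) (map snd xs ! i)]
      @ drop (i + 1) (map snd xs)), 0)"
proof -
  obtain a u b v where x: "xs ! (i - 1) = (a, u)" "xs ! i = (b, v)" by fastforce
  have "drop (i - 1) xs = xs ! (i - 1) # xs ! i # drop (i + 1) xs"
    using assms Cons_nth_drop_Suc[of "i - 1" xs] Cons_nth_drop_Suc[of i xs] by simp
  then have "take 2 (drop (i - 1) xs) = [(a, u), (b, v)]"
    using x by simp
  moreover have "R_outer n i 2 y = del_leaf i y"
    by (simp add: R_outer_def)
  moreover have "map snd xs ! (i - 1) = u" "map snd xs ! i = v"
    using assms x by simp_all
  ultimately show ?thesis
    using star_middle_iff[OF assms(1-3)]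
    by (cases "star i y") (simp_all add: circ_def ext_def D_eq take_map drop_map)
qed

section \<open>Comparison of the two operators by degree\<close>

lemma d_P_eq_delta_P_degree_0:
  assumes "size y = 1" "length xs = 1"
  shows "d_P lact ract P 0 f y xs = ext (delta_P lact ract P 0 f) y xs"
proof -
  have y: "y = Node Leaf () Leaf"
    using assms by (cases y) auto
  obtain a u where xs: "xs = [(a, u)]"
    using assms by (cases xs) auto
  show ?thesis
    \<comment> \<open>Here \<open>star 0 y\<close> is \<open>Dashv\<close> and
      \<open>star 1 y\<close> is \<open>Vdash\<close>, the cases in which the actions carry a
      correction by \<open>P\<close>. By \<open>P_diff\<close> the two corrections add up to the
      first term of \<open>bracket_elem\<close>.\<close>
    by (simp add: y xs d_P_def bracket_def bracket_elem_def ext_def map_cochain_def delta_P_def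
        diass_coboundary_def star_def graft_def signed_def P_diff)
qed

lemma d_P_eq_delta_P_degree_pos:
  assumes "size y = n + 1" "1 \<le> n" "length xs = n + 1"
  shows "d_P lact ract P n f y xs = ext (\<lambda>y us. signed n (delta_P lact ract P n f y us)) y xs"
proof -
  let ?us = "map snd xs"
  define first where
    "first = lrep_P ract P (star 0 y) (?us ! 0) (f (del_leaf 0 y) (drop 1 ?us))"
  define mid where "mid i = f (del_leaf i y) (take (i - 1) ?us
    @ [mult_P lact ract P (star i y) (?us ! (i - 1)) (?us ! i)] @ drop (i + 1) ?us)" for i
  define last where
    "last = rrep_P lact P (star (n + 1) y) (f (del_leaf (n + 1) y) (take n ?us)) (?us ! n)"
  have mid_sum: "(\<Sum>i = 1..n. signed (i - 1) (circ n (ext f) i 2 D y xs))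
      = (\<Sum>i = 1..n. signed (i - 1) (mid i), 0)"
    unfolding sum_Pair_0[symmetric]
    by (intro sum.cong refl) (simp add: circ_ext_D assms mid_def signed_Pair)
  have "d_P lact ract P n f y xs = signed 1 (MM 2 D n (ext f) y xs)"
    using assms(2) unfolding D_def by (simp add: d_P_def bracket_def numeral_2_eq_2)
  moreover have "{1..2} = {1, 2::nat}" by auto
  ultimately have "d_P lact ract P n f y xs = - (circ 2 D 1 n (ext f) y xs
      + signed (n - 1) (circ 2 D 2 n (ext f) y xs)
      - signed (n - 1) (\<Sum>i = 1..n. signed (i - 1) (circ n (ext f) i 2 D y xs)))"
    by (simp add: MM_def signed_def[of "Suc 0"] signed_def[of 0])
  also have "\<dots> = (- last - signed (n - 1) first
      + signed (n - 1) (\<Sum>i = 1..n. signed (i - 1) (mid i)), 0)"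
    unfolding mid_sum circ_D_left[OF assms] circ_D_right[OF assms]
      first_def[symmetric] last_def[symmetric]
    by (simp add: signed_Pair)
  also have "- last - signed (n - 1) first + signed (n - 1) (\<Sum>i = 1..n. signed (i - 1) (mid i))
      = signed n (first + (\<Sum>i = 1..n. signed i (mid i)) + signed (n + 1) last)"
  proof -
    \<comment> \<open>As \<open>n\<close> and \<open>i\<close> are positive, the truncated
      subtractions are exact and \<open>(n - 1) + (i - 1)\<close> has the parity of
      \<open>n + i\<close>.\<close>
    have "signed (n - 1) (\<Sum>i = 1..n. signed (i - 1) (mid i)) = signed n (\<Sum>i = 1..n. signed i (mid i))"
      unfolding signed_sum signed_signed
      using assms(2) by (intro sum.cong refl) (auto simp: signed_def)
    moreover have "signed (n - 1) first = - signed n first"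
      using assms(2) by (simp add: signed_def)
    ultimately show ?thesis
      by (simp add: signed_add signed_signed) (simp add: signed_def)
  qed
  finally show ?thesis
    by (simp add: ext_def delta_P_def diass_coboundary_def first_def mid_def last_def)
qed

end

theorem proposition4p4:
  fixes scaleA :: "'k::field_char_0 \<Rightarrow> 'a::ring \<Rightarrow> 'a"
    and scaleM :: "'k \<Rightarrow> 'm::ab_group_add \<Rightarrow> 'm"
    and lact :: "'a \<Rightarrow> 'm \<Rightarrow> 'm"
    and ract :: "'m \<Rightarrow> 'a \<Rightarrow> 'm"
    and P :: "'m \<Rightarrow> 'a"
    and n :: nat
    and f :: "('m, 'a) cochain"
  assumes "relative_averaging scaleA scaleM lact ract P"
    and "f \<in> CY scaleM scaleA n"
  shows "\<forall>y\<in>trees (n + 1). \<forall>xs. length xs = n + 1 \<longrightarrow>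
    d_P lact ract P n f y xs = ext (\<lambda>y us. signed n (delta_P lact ract P n f y us)) y xs"
proof (intro ballI allI impI)
  interpret relative_averaging scaleA scaleM lact ract P by fact
  fix y :: ptree and xs :: "('a \<times> 'm) list"
  assume "y \<in> trees (n + 1)" and xs: "length xs = n + 1"
  then have y: "size y = n + 1" by (simp add: trees_def)
  show "d_P lact ract P n f y xs = ext (\<lambda>y us. signed n (delta_P lact ract P n f y us)) y xs"
  proof (cases "n = 0")
    case True
    then show ?thesis
      using d_P_eq_delta_P_degree_0[of y xs f] y xs by (simp add: signed_def)
  next
    case False
    then show ?thesis
      using d_P_eq_delta_P_degree_pos[of y n xs f] y xs by simp
  qed
qed

end
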